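(* Let $V$ be a valuation ring and let $n\geq 3$ be an integer. Then $\mathrm{SL}_n(V[x])=E_n(V[x])$. Furthermore, every matrix $\sigma(x)\in \mathrm{SL}_n(V[x])$ is congruent to $\sigma(0)$ modulo $E_n(V[x])$, i.e. there is $E\in E_n(V[x])$ such that $\sigma(x)\cdot E=\sigma(0)$.
   Context: All rings are commutative with unity. A valuation ring is a commutative ring $V$ whose principal ideals are totally ordered by inclusion, i.e. for any $a,b\in V$ either $a\mid b$ or $b\mid a$ (zero divisors are allowed; $V$ need not be a domain). For a commutative ring $R$, $\mathrm{SL}_n(R)$ is the group of $n\times n$ matrices over $R$ of determinant $1$, and $E_n(R)$ is the subgroup generated by the elementary matrices $I_n+a\,\mathbf{e}_{ij}$ with $a\in R$, $i\neq j$, where $\mathbf{e}_{ij}$ is the matrix whose only nonzero entry is $1$ at position $(i,j)$. For $\sigma(x)\in \mathrm{SL}_n(R[x])$, $\sigma(0)\in \mathrm{SL}_n(R)$ is obtained by substituting $x=0$ in every entry; it is regarded as a constant matrix in $\mathrm{SL}_n(R[x])$. *)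

theory Defs
  imports
    "Jordan_Normal_Form.Determinant"
    "HOL-Algebra.Generated_Groups"
    "HOL-Computational_Algebra.Polynomial"
begin

(* Divisibility is total on all of 'a; zero divisors are allowed, since 'a need not be an idom. *)
definition valuation_ring :: "'a::comm_ring_1 itself \<Rightarrow> bool" where
  "valuation_ring _ \<longleftrightarrow> (\<forall>a b :: 'a. a dvd b \<or> b dvd a)"

definition SL :: "nat \<Rightarrow> 'a::comm_ring_1 mat monoid" where
  "SL n = \<lparr>carrier = {A \<in> carrier_mat n n. det A = 1}, mult = (*), one = 1\<^sub>m n\<rparr>"

(* addrow_mat n a i j is the identity matrix with a added at position (i, j). *)
definition elementary_mats :: "nat \<Rightarrow> 'a::comm_ring_1 mat set" where
  "elementary_mats n = {addrow_mat n a i j | a i j. i < n \<and> j < n \<and> i \<noteq> j}"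

definition E :: "nat \<Rightarrow> 'a::comm_ring_1 mat set" where
  "E n = generate (SL n) (elementary_mats n)"

definition eval_mat :: "'a::comm_ring_1 poly mat \<Rightarrow> 'a \<Rightarrow> 'a mat" where
  "eval_mat \<sigma> c = map_mat (\<lambda>p. poly p c) \<sigma>"

definition const_mat :: "'a::comm_ring_1 mat \<Rightarrow> 'a poly mat" where
  "const_mat A = map_mat (\<lambda>a. [:a:]) A"

lemma SL_simps [simp]:
  "A \<in> carrier (SL n) \<longleftrightarrow> A \<in> carrier_mat n n \<and> det A = 1"
  "mult (SL n) = (*)" "one (SL n) = 1\<^sub>m n"
  by (simp_all add: SL_def)

lemma group_SL: "group (SL n :: 'a::comm_ring_1 mat monoid)"
proof (rule groupI)
  fix A :: "'a mat" assume "A \<in> carrier (SL n)"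
  then have A: "A \<in> carrier_mat n n" and d: "det A = 1" by auto
  from adj_mat[OF A] d have B: "adj_mat A \<in> carrier_mat n n" "adj_mat A * A = 1\<^sub>m n"
    by auto
  then have "det (adj_mat A) * det A = 1" using det_mult[OF B(1) A] by simp
  with B d show "\<exists>B\<in>carrier (SL n). B \<otimes>\<^bsub>SL n\<^esub> A = \<one>\<^bsub>SL n\<^esub>" by auto
qed (auto simp: det_mult assoc_mult_mat[of _ n n _ n _ n])

lemma elementary_mats_subset_SL: "elementary_mats n \<subseteq> carrier (SL n)"
  by (auto simp: elementary_mats_def det_addrow_mat)

lemma subgroup_E: "subgroup (E n) (SL n)"
  unfolding E_def by (rule group.generate_is_subgroup[OF group_SL elementary_mats_subset_SL])

lemma eval_mat_in_SL:
  assumes "\<sigma> \<in> carrier (SL n)"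
  shows "eval_mat \<sigma> c \<in> carrier (SL n)"
proof -
  interpret comm_ring_hom "\<lambda>p. poly p c" by unfold_locales auto
  from assms show ?thesis by (auto simp: eval_mat_def)
qed

lemma const_mat_in_SL:
  fixes A :: "'a::comm_ring_1 mat"
  assumes "A \<in> carrier (SL n)"
  shows "const_mat A \<in> carrier (SL n)"
proof -
  interpret comm_ring_hom "\<lambda>a::'a. [:a:]" by unfold_locales (auto simp: one_pCons)
  from assms show ?thesis by (auto simp: const_mat_def)
qed

end

theory Submission
  imports Defs
begin

text \<open>
  The second claim is a consequence of the first, because \<open>\<sigma>\<close> and
  \<open>\<sigma>(0)\<close> are both elementary. For the first claim, the usual arguments over a
  local ring divide by monic polynomials, and over a valuation ring a polynomial need not have a
  unit as leading coefficient, even after removal of its content. The idea is to work from the other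
  end. The ring \<open>V\<close> is local, so in a unimodular row some entry \<open>f\<close> has a
  unit as constant term, and one can divide by \<open>f\<close> starting with the low coefficients:
  unless \<open>f\<close> is constant, and hence a unit, every \<open>g\<close> has the form
  \<open>c f + x^k h\<close> with \<open>degree h < degree f\<close>
  (\<open>divide_from_below\<close>). Divisibility in \<open>V\<close> is total, so a nonzero
  \<open>h\<close> is a constant, its content, times a primitive polynomial. If \<open>x^k\<close>
  and the content can be discarded, a primitive polynomial of smaller degree remains, which a few
  more divisions endow with a unit constant term (\<open>divide_to_unit_constant_term\<close>), and
  the descent continues with it in place of \<open>f\<close> until an entry is a unit.

  What has to be shown is that such factors, which are comaximal with \<open>f\<close>, can be
  discarded. In a row of length at least three, a factor shared by two entries is invertible modulo
  \<open>f\<close> and can be moved from one of them to the other by Whitehead's lemma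
  (\<open>row_equiv_move_factor\<close>). So every unimodular row of length at least three is
  elementary equivalent to a unit vector (\<open>unimodular_row_equiv_unit_vector\<close>), and a
  matrix in \<open>SL\<^sub>n\<close> reduces to a block of size two, placed in
  \<open>SL\<^sub>3\<close>.

  For a block of size two with first row \<open>(f, b w)\<close>, a factor \<open>b\<close> modulo
  which \<open>f\<close> is congruent to \<open>1\<close> can be carried over to the opposite corner
  with the help of the third coordinate (\<open>mat3_move_factor\<close>). This covers the powers of
  \<open>x\<close>. A constant \<open>b\<close> comaximal with \<open>f\<close> makes
  \<open>f\<close> a unit modulo \<open>b\<close>, so that the coefficients of
  \<open>f - f(0)\<close> are nilpotent modulo \<open>b\<close>
  (\<open>nilpotent_coeffs_of_unit_mod\<close>); then \<open>b\<close> can be removed in finitely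
  many steps, each one removing the content of \<open>f - f(0)\<close> or, at the end, what is left
  of \<open>b\<close> (\<open>sl2_elementary_drop_nilpotent_factor\<close>). The descent on degrees
  therefore applies to these rows of length two as well.
\<close>

section \<open>Valuation rings and the polynomials over them\<close>

lemma valuation_dvd_total:
  "valuation_ring TYPE('v::comm_ring_1) \<Longrightarrow> (a::'v) dvd b \<or> b dvd a"
  by (auto simp: valuation_ring_def)

text \<open>
  A valuation ring is local: of two summands one divides the other, hence divides the sum, and a
  divisor of a unit is a unit.
\<close>

lemma dvd_one_add:
  fixes a b :: "'v::comm_ring_1"
  assumes V: "valuation_ring TYPE('v)" and u: "a + b dvd 1"
  shows "a dvd 1 \<or> b dvd 1"
  using valuation_dvd_total[OF V, of a b]
proof
  assume "a dvd b"
  then have "a dvd a + b" by simp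
  with u show ?thesis using dvd_trans by blast
next
  assume "b dvd a"
  then have "b dvd a + b" by simp
  with u show ?thesis using dvd_trans by blast
qed

lemma dvd_one_sum:
  fixes f :: "'i \<Rightarrow> 'v::comm_ring_1"
  assumes V: "valuation_ring TYPE('v)"
  shows "sum f A dvd 1 \<Longrightarrow> \<exists>x\<in>A. f x dvd 1"
proof (induction A rule: infinite_finite_induct)
  case (insert x A)
  then show ?case using dvd_one_add[OF V, of "f x" "sum f A"] by auto
qed auto

text \<open>
  This is what makes contents available: the content of a polynomial, or of several polynomials at
  once, is one of their coefficients.
\<close>

lemma finite_ex_least_dvd:
  fixes S :: "'v::comm_ring_1 set"
  assumes V: "valuation_ring TYPE('v)"
  shows "finite S \<Longrightarrow> S \<noteq> {} \<Longrightarrow> \<exists>b\<in>S. \<forall>s\<in>S. b dvd s"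
proof (induction S rule: finite_ne_induct)
  case (insert x S)
  then obtain b where b: "b \<in> S" "\<forall>s\<in>S. b dvd s" by blast
  from valuation_dvd_total[OF V, of b x] show ?case
  proof
    assume "x dvd b"
    then have "\<forall>s\<in>insert x S. x dvd s" using b(2) dvd_trans[of x b] by simp
    then show ?thesis by simp
  next
    assume "b dvd x"
    then have "\<forall>s\<in>insert x S. b dvd s" using b(2) by simp
    with b(1) show ?thesis by (intro bexI[of _ b]) simp_all
  qed
qed auto

text \<open>
  Quotients by a zero divisor are not unique. The cofactors of zero coefficients are chosen to be
  zero, which keeps the degree from growing, and the cofactor of a coefficient equal to
  \<open>b \<noteq> 0\<close> is chosen to be \<open>1\<close>, which makes the quotient primitive
  (some coefficient is a unit).
\<close>

lemma smult_of_dvd_coeffs: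
  fixes p :: "'a::comm_ring_1 poly"
  assumes "\<And>i. b dvd coeff p i"
  shows "\<exists>q. p = smult b q \<and> degree q \<le> degree p \<and> (\<forall>i. coeff p i = b \<longrightarrow> b \<noteq> 0 \<longrightarrow> coeff q i = 1)"
proof -
  have "\<exists>c. coeff p i = b * c \<and> (coeff p i = b \<longrightarrow> c = 1 \<or> b = 0) \<and> (coeff p i = 0 \<longrightarrow> c = 0)" for i
  proof (cases "coeff p i = 0 \<or> coeff p i = b")
    case True
    then show ?thesis by (cases "b = 0") (auto intro: exI[of _ 0] exI[of _ 1])
  next
    case False
    with assms[of i] show ?thesis by (auto simp: dvd_def)
  qed
  then obtain c where c: "coeff p i = b * c i" "coeff p i = b \<longrightarrow> c i = 1 \<or> b = 0"
    "coeff p i = 0 \<longrightarrow> c i = 0" for i by metis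
  define q where "q = Abs_poly c"
  have fin: "c i = 0" if "degree p < i" for i using c(3) coeff_eq_0[OF that] by blast
  then have q: "coeff q = c" unfolding q_def by (auto intro: coeff_Abs_poly)
  show ?thesis
  proof (intro exI[of _ q] conjI)
    show "p = smult b q" by (rule poly_eqI) (use c q in auto)
    show "degree q \<le> degree p" by (rule degree_le) (use fin q in auto)
    show "\<forall>i. coeff p i = b \<longrightarrow> b \<noteq> 0 \<longrightarrow> coeff q i = 1" using c(2) q by auto
  qed
qed

lemma ex_smult_content:
  fixes p :: "'v::comm_ring_1 poly"
  assumes V: "valuation_ring TYPE('v)" and p: "p \<noteq> 0"
  shows "\<exists>b q i. p = smult b q \<and> b = coeff p i \<and> b \<noteq> 0 \<and> degree q \<le> degree p \<and> coeff q i = 1"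
proof -
  let ?S = "coeff p ` {i. i \<le> degree p \<and> coeff p i \<noteq> 0}"
  have "?S \<noteq> {}" using p leading_coeff_0_iff by blast
  from finite_ex_least_dvd[OF V _ this] obtain b where b: "b \<in> ?S" "\<forall>s\<in>?S. b dvd s" by auto
  then have "b dvd coeff p i" for i
    by (cases "coeff p i = 0") (auto simp: le_degree)
  from smult_of_dvd_coeffs[OF this] obtain q where
    q: "p = smult b q" "degree q \<le> degree p" "\<And>i. coeff p i = b \<Longrightarrow> b \<noteq> 0 \<Longrightarrow> coeff q i = 1"
    by blast
  from b(1) obtain i where i: "b = coeff p i" "b \<noteq> 0" by blast
  then have "coeff q i = 1" using q(3)[of i] by metis
  with q(1,2) i have "p = smult b q \<and> b = coeff p i \<and> b \<noteq> 0 \<and> degree q \<le> degree p \<and> coeff q i = 1"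
    by (intro conjI) assumption+
  then show ?thesis by (rule exI[of _ b, OF exI[of _ q, OF exI[of _ i]]])
qed

lemma unit_constant_poly: "c dvd (1::'a::comm_ring_1) \<Longrightarrow> [:c:] dvd 1"
proof -
  assume "c dvd 1"
  then obtain u where "1 = c * u" by (auto simp: dvd_def)
  then have "1 = [:c:] * [:u:]" by (simp add: one_pCons mult.commute)
  then show ?thesis by (rule dvdI)
qed

lemma split_constant_term:
  fixes p :: "'a::comm_ring_1 poly"
  shows "\<exists>t. p = [:coeff p 0:] + monom 1 1 * t \<and> (\<forall>i. coeff p (Suc i) = coeff t i)"
  by (cases p) (auto simp: monom_altdef)

lemma cancel_constant_term:
  fixes f g :: "'a::comm_ring_1 poly"
  assumes "a * coeff f 0 = coeff g 0"
  shows "\<exists>h. g = smult a f + pCons 0 h \<and> degree h \<le> max (degree f) (degree g) - 1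
    \<and> (\<forall>i. coeff h i = coeff g (Suc i) - a * coeff f (Suc i))"
proof -
  obtain z h where zh: "g - smult a f = pCons z h" by (cases "g - smult a f")
  then have co: "coeff (g - smult a f) (Suc i) = coeff h i" for i by simp
  have "z = coeff (g - smult a f) 0" using zh by simp
  with assms have z: "z = 0" by simp
  have "degree (g - smult a f) \<le> max (degree f) (degree g)"
    by (intro degree_diff_le) (auto intro: order_trans[OF degree_smult_le])
  with zh z have "degree h \<le> max (degree f) (degree g) - 1"
    by (cases "h = 0") auto
  moreover have "g = smult a f + pCons 0 h" using zh z by (metis add.commute diff_add_cancel)
  ultimately show ?thesis using co by auto
qed

text \<open>
  Division by a polynomial with a unit constant term, carried out from the low coefficients upwards.
  It takes the place of division by a monic polynomial: for \<open>k \<ge> degree g\<close> and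
  nonconstant \<open>f\<close> the cofactor \<open>h\<close> has smaller degree than
  \<open>f\<close>, at the price of a factor \<open>x^k\<close>. That factor is comaximal with
  \<open>f\<close>, and the sections below show how to discard it.
\<close>

lemma divide_from_below:
  fixes f g :: "'a::comm_ring_1 poly"
  assumes f0: "coeff f 0 dvd 1"
  shows "\<exists>c h. g = c * f + monom 1 k * h \<and> degree h \<le> max (degree f - 1) (degree g - k)"
proof (induction k)
  case 0
  show ?case by (rule exI[of _ 0], rule exI[of _ g]) auto
next
  case (Suc k)
  then obtain c h where h: "g = c * f + monom 1 k * h"
    "degree h \<le> max (degree f - 1) (degree g - k)" by blast
  from f0 obtain a where "coeff h 0 = a * coeff f 0"
    by (metis dvd_def mult.commute mult.left_commute mult_1_right)
  from cancel_constant_term[OF this[symmetric]] obtain h' where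
    h': "h = smult a f + pCons 0 h'" "degree h' \<le> max (degree f) (degree h) - 1" by blast
  have "pCons 0 h' = monom 1 1 * h'" by (simp add: monom_altdef)
  then have "monom 1 k * pCons 0 h' = monom 1 (Suc k) * h'"
    by (simp only: mult.assoc[symmetric] mult_monom) simp
  then have "g = (c + monom 1 k * [:a:]) * f + monom 1 (Suc k) * h'"
    using h(1) h'(1) by (simp add: algebra_simps)
  moreover have "degree h' \<le> max (degree f - 1) (degree g - Suc k)"
    using h(2) h'(2) by auto
  ultimately show ?case by blast
qed

lemma comaximal_monom:
  fixes f :: "'a::comm_ring_1 poly"
  assumes "coeff f 0 dvd 1"
  shows "\<exists>u t. u * f + t * monom 1 k = 1"
  using divide_from_below[OF assms, of 1 k] by (metis mult.commute)

text \<open>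
  As long as the constant term of \<open>g\<close> is not a unit, the quotient \<open>a\<close> of
  the constant terms is not a unit either, so dividing \<open>g - a f\<close> by \<open>x\<close>
  moves the unit coefficient of \<open>g\<close> one place down and keeps it a unit.
\<close>

lemma divide_to_unit_constant_term:
  fixes f g :: "'v::comm_ring_1 poly"
  assumes V: "valuation_ring TYPE('v)"
    and f: "coeff f 0 dvd 1" "degree f \<le> Suc e"
  shows "coeff g m dvd 1 \<Longrightarrow> degree g \<le> e \<Longrightarrow>
    \<exists>c k h. g = c * f + monom 1 k * h \<and> coeff h 0 dvd 1 \<and> degree h \<le> e"
proof (induction m arbitrary: g)
  case 0
  then show ?case by (intro exI[of _ "0 :: 'v poly"] exI[of _ "0::nat"] exI[of _ g]) auto
next
  case (Suc m)
  show ?case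
  proof (cases "coeff g 0 dvd 1")
    case True
    with Suc.prems show ?thesis by (intro exI[of _ "0 :: 'v poly"] exI[of _ "0::nat"] exI[of _ g]) auto
  next
    case False
    from f(1) obtain a where a: "coeff g 0 = a * coeff f 0"
      by (metis dvd_def mult.commute mult.left_commute mult_1_right)
    from cancel_constant_term[OF a[symmetric]] obtain h where
      h: "g = smult a f + pCons 0 h" "degree h \<le> max (degree f) (degree g) - 1"
         "coeff h m = coeff g (Suc m) - a * coeff f (Suc m)" by blast
    have "\<not> a dvd 1"
    proof
      assume "a dvd 1"
      then have "a * coeff f 0 dvd 1 * 1" using f(1) by (rule mult_dvd_mono)
      with a False show False by simp
    qed
    then have "\<not> a * coeff f (Suc m) dvd 1" using dvd_mult_left by blast
    moreover have "coeff h m + a * coeff f (Suc m) dvd 1" using h(3) Suc.prems(1) by simp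
    ultimately have "coeff h m dvd 1" using dvd_one_add[OF V] by blast
    moreover have "degree h \<le> e" using h(2) Suc.prems(2) f(2) by auto
    ultimately obtain c k h' where
      h': "h = c * f + monom 1 k * h'" "coeff h' 0 dvd 1" "degree h' \<le> e"
      using Suc.IH by blast
    have "pCons 0 h = monom 1 1 * h" by (simp add: monom_altdef)
    then have "pCons 0 h = monom 1 1 * c * f + (monom 1 1 * monom 1 k) * h'"
      using h'(1) by (simp add: algebra_simps)
    then have "g = ([:a:] + monom 1 1 * c) * f + monom 1 (Suc k) * h'"
      using h(1) by (simp add: algebra_simps mult_monom)
    with h'(2,3) show ?thesis by blast
  qed
qed

text \<open>
  The radical of a principal ideal of a valuation ring is prime; it is enough to compare the two
  factors.
\<close>

lemma valuation_prime_radical: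
  fixes b r s :: "'v::comm_ring_1"
  assumes V: "valuation_ring TYPE('v)" and "b dvd (r * s) ^ k"
  shows "(\<exists>k. b dvd r ^ k) \<or> (\<exists>k. b dvd s ^ k)"
  using valuation_dvd_total[OF V, of r s]
proof
  assume "r dvd s"
  then have "r * s dvd s ^ 2" by (simp add: power2_eq_square mult_dvd_mono)
  then have "(r * s) ^ k dvd s ^ (2 * k)" by (metis dvd_power_same power_mult)
  with assms(2) show ?thesis using dvd_trans by blast
next
  assume "s dvd r"
  then have "r * s dvd r ^ 2" by (simp add: power2_eq_square mult_dvd_mono)
  then have "(r * s) ^ k dvd r ^ (2 * k)" by (metis dvd_power_same power_mult)
  with assms(2) show ?thesis using dvd_trans by blast
qed

lemma valuation_radical_add:
  fixes b r s :: "'v::comm_ring_1"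
  assumes V: "valuation_ring TYPE('v)" and "\<exists>k. b dvd r ^ k" "\<exists>k. b dvd s ^ k"
  shows "\<exists>k. b dvd (r + s) ^ k"
proof -
  have "r dvd r + s \<or> s dvd r + s" using valuation_dvd_total[OF V, of r s] by auto
  with assms(2,3) show ?thesis by (meson dvd_power_same dvd_trans)
qed

lemma valuation_radical_sum:
  fixes f :: "'i \<Rightarrow> 'v::comm_ring_1"
  assumes V: "valuation_ring TYPE('v)"
  shows "(\<And>i. i \<in> A \<Longrightarrow> \<exists>k. b dvd f i ^ k) \<Longrightarrow> \<exists>k. b dvd sum f A ^ k"
proof (induction A rule: infinite_finite_induct)
  case (insert x A)
  then show ?case using valuation_radical_add[OF V, of b "f x" "sum f A"] by auto
qed (auto intro: exI[of _ 1])

text \<open>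
  A polynomial that is a unit modulo \<open>b\<close> has a unit as constant term modulo
  \<open>b\<close>, and its other coefficients are nilpotent modulo \<open>b\<close>. The radical
  \<open>P\<close> of \<open>(b)\<close> is prime, so degrees modulo \<open>P\<close> are additive,
  and a product equal to \<open>1\<close> modulo \<open>P\<close> has two factors of degree zero
  modulo \<open>P\<close>. The proof reads off the product of the two leading coefficients modulo
  \<open>P\<close>.
\<close>

lemma nilpotent_coeffs_of_unit_mod:
  fixes f u s :: "'v::comm_ring_1 poly"
  assumes V: "valuation_ring TYPE('v)" and 1: "u * f + s * [:b:] = 1" and i: "i > 0"
  shows "\<exists>k. b dvd coeff f i ^ k"
proof (rule ccontr)
  define P where "P r \<longleftrightarrow> (\<exists>k. b dvd r ^ k)" for r :: 'v
  have P_mult: "P (r * s)" if "P r" for r s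
    using that unfolding P_def by (metis dvd_mult2 power_mult_distrib)
  have P_prime: "P r \<or> P s" if "P (r * s)" for r s
    using that valuation_prime_radical[OF V, of b r s] unfolding P_def by blast
  have P_add: "P (r + s)" if "P r" "P s" for r s
    using that valuation_radical_add[OF V, of b r s] unfolding P_def by blast
  have P_sum: "P (sum g A)" if "\<And>i. i \<in> A \<Longrightarrow> P (g i)" for g :: "nat \<Rightarrow> 'v" and A
    using that valuation_radical_sum[OF V, of A b g] unfolding P_def by blast
  have P_b: "P (b * r)" for r unfolding P_def by (intro exI[of _ 1]) auto
  assume "\<not> ?thesis"
  then have fi: "\<not> P (coeff f i)" by (simp add: P_def)
  have coeffs: "coeff (u * f) j + b * coeff s j = (if j = 0 then 1 else 0)" for j
    using arg_cong[OF 1, of "\<lambda>p. coeff p j"] by (simp add: mult.commute one_pCons coeff_pCons split: nat.splits)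
  have nP1: "\<not> P 1"
  proof
    assume "P 1"
    from P_mult[OF this, of "coeff f i"] fi show False by simp
  qed
  have "\<exists>j. \<not> P (coeff u j)"
  proof (rule ccontr)
    assume "\<not> ?thesis"
    then have "P (coeff (u * f) 0)" by (simp add: coeff_mult P_mult)
    with coeffs[of 0] P_add[OF _ P_b] nP1 show False by metis
  qed
  have P0: "P 0" using P_b[of 0] by simp
  have fin: "finite {j. \<not> P (coeff p j)}" for p :: "'v poly"
  proof (rule finite_subset)
    show "{j. \<not> P (coeff p j)} \<subseteq> {..degree p}"
    proof clarsimp
      fix j assume "\<not> P (coeff p j)"
      with P0 have "coeff p j \<noteq> 0" by metis
      then show "j \<le> degree p" by (rule le_degree)
    qed
  qed simp
  \<comment> \<open>The degrees of \<open>f\<close> and \<open>u\<close> modulo \<open>P\<close>.\<close>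
  define m where "m = Max {j. \<not> P (coeff f j)}"
  define l where "l = Max {j. \<not> P (coeff u j)}"
  have m: "\<not> P (coeff f m)" using Max_in[OF fin, of f] fi unfolding m_def by blast
  have m_max: "P (coeff f j)" if "j > m" for j
    using Max_ge[OF fin, of j f] that unfolding m_def by (meson leD mem_Collect_eq)
  have mi: "m \<ge> i" using Max_ge[OF fin, of i f] fi unfolding m_def by blast
  have l: "\<not> P (coeff u l)"
    using Max_in[OF fin, of u] \<open>\<exists>j. \<not> P (coeff u j)\<close> unfolding l_def by blast
  have l_max: "P (coeff u j)" if "j > l" for j
    using Max_ge[OF fin, of j u] that unfolding l_def by (meson leD mem_Collect_eq)
  let ?t = "\<lambda>j. coeff u j * coeff f (l + m - j)"
  have "P (sum ?t ({..l + m} - {l}))"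
  proof (rule P_sum)
    fix j assume "j \<in> {..l + m} - {l}"
    then consider "j > l" | "l + m - j > m" by force
    then show "P (?t j)"
    proof cases
      case 1
      then show ?thesis using l_max P_mult by blast
    next
      case 2
      then show ?thesis using m_max P_mult by (metis mult.commute)
    qed
  qed
  moreover have "P (coeff (u * f) (l + m))"
  proof -
    have "coeff (u * f) (l + m) = b * (- coeff s (l + m))"
      using coeffs[of "l + m"] mi i by (simp add: eq_neg_iff_add_eq_0)
    then show ?thesis using P_b by metis
  qed
  moreover have "coeff (u * f) (l + m) = ?t l + sum ?t ({..l + m} - {l})"
    unfolding coeff_mult by (rule sum.remove) auto
  ultimately have "P (?t l)"
    using P_add[of "coeff (u * f) (l + m)" "sum ?t ({..l + m} - {l}) * (-1)"]
      P_mult[of "sum ?t ({..l + m} - {l})" "-1"] by simp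
  then have "P (coeff u l) \<or> P (coeff f m)"
    using P_prime[of "coeff u l" "coeff f m"] by simp
  with m l show False by blast
qed

section \<open>Unimodular rows\<close>

definition unimodular :: "nat \<Rightarrow> (nat \<Rightarrow> 'a::comm_ring_1) \<Rightarrow> bool" where
  "unimodular n v \<longleftrightarrow> (\<exists>u. (\<Sum>i<n. u i * v i) = 1)"

text \<open>
  Elementary column operations are recorded on a single row, as a function of the column index; only
  the values at indices below \<open>n\<close> matter.
\<close>

inductive row_equiv :: "nat \<Rightarrow> (nat \<Rightarrow> 'a::comm_ring_1) \<Rightarrow> (nat \<Rightarrow> 'a) \<Rightarrow> bool" for n v where
  refl: "row_equiv n v v"
| step: "row_equiv n v w \<Longrightarrow> i < n \<Longrightarrow> j < n \<Longrightarrow> i \<noteq> j \<Longrightarrow> row_equiv n v (w(j := w j + a * w i))"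

lemma row_equiv_trans:
  assumes "row_equiv n v w" "row_equiv n w x"
  shows "row_equiv n v x"
  using assms(2,1) by induction (auto intro: row_equiv.intros)

lemma row_equiv_add:
  assumes "row_equiv n v w" "i < n" "j < n" "i \<noteq> j" "x = w j + a * w i"
  shows "row_equiv n v (w(j := x))"
  using row_equiv.step[OF assms(1-4), of a] assms(5) by simp

lemma unimodular_row_equiv:
  assumes "row_equiv n v w" "unimodular n v"
  shows "unimodular n w"
  using assms
proof induction
  case (step w i j a)
  then obtain u where u: "(\<Sum>k<n. u k * w k) = 1" by (auto simp: unimodular_def)
  let ?w = "w(j := w j + a * w i)" and ?u = "u(i := u i - u j * a)"
  have "(\<Sum>k<n. ?u k * ?w k) = (\<Sum>k<n. u k * w k + ((if k = j then u j * a * w i else 0)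
      - (if k = i then u j * a * w i else 0)))"
    using step.hyps by (intro sum.cong) (auto simp: algebra_simps)
  also have "\<dots> = 1"
    using u step.hyps by (simp add: sum.distrib sum_subtractf)
  finally show ?case unfolding unimodular_def by blast
qed

lemma row_equiv_pivot:
  assumes i: "i < n" and J: "finite J" "J \<subseteq> {..<n} - {i}"
  shows "row_equiv n v (\<lambda>j. if j \<in> J then v j + c j * v i else v j)"
  using J
proof (induction J rule: finite_induct)
  case empty
  then show ?case by (simp add: row_equiv.refl)
next
  case (insert k J)
  let ?w = "\<lambda>j. if j \<in> J then v j + c j * v i else v j"
  from insert have "row_equiv n v ?w" by auto
  moreover have "k < n" "i \<noteq> k" "i \<notin> J" using insert.prems by auto
  ultimately have "row_equiv n v (?w(k := v k + c k * v i))"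
    using i insert.hyps(2) by (intro row_equiv_add[where i = i and a = "c k"]) auto
  moreover have "?w(k := v k + c k * v i) = (\<lambda>j. if j \<in> insert k J then v j + c j * v i else v j)"
    by auto
  ultimately show ?case by simp
qed

text \<open>
  Modulo \<open>v i\<close> the element \<open>b\<close> is invertible with inverse
  \<open>t\<close>, and the matrix \<open>diag(t, b)\<close> is then a product of four elementary
  matrices (Whitehead). It turns the pair \<open>(b g, b h)\<close> into
  \<open>(g, b\<^sup>2 h)\<close> modulo \<open>v i\<close>, and the errors are multiples of
  \<open>v i\<close>, which two further operations remove. So a common factor of two entries can be
  cleared from either one of them.
\<close>

lemma row_equiv_move_factor:
  assumes ijk: "i < n" "j < n" "k < n" "i \<noteq> j" "i \<noteq> k" "j \<noteq> k"
    and vj: "v j = b * g" and vk: "v k = b * h" and ut: "u * v i + t * b = 1"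
  shows "row_equiv n v (v(j := g, k := b * b * h))"
proof -
  let ?f = "v i"
  define y1 x1 y2 x2 where "y1 = v k + (t - 1) * v j" and "x1 = v j + 1 * y1"
    and "y2 = y1 + (b - 1) * x1" and "x2 = x1 + (- t) * y2"
  have uf: "u * ?f = 1 - t * b" using ut by (simp add: algebra_simps)
  \<comment> \<open>The two entries after the four operations, exact and not only modulo \<open>v i\<close>.\<close>
  have y2: "y2 = b * b * h - b * g * (u * ?f)"
    unfolding y2_def x1_def y1_def vj vk uf by (simp add: algebra_simps)
  have x2: "x2 = g + (b * h - g * u * ?f) * (u * ?f)"
    unfolding x2_def y2_def x1_def y1_def vj vk mult.assoc[of g] uf by (simp add: algebra_simps)
  let ?v1 = "v(k := y1)" let ?v2 = "?v1(j := x1)" let ?v3 = "?v2(k := y2)" let ?v4 = "?v3(j := x2)"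
  have 1: "row_equiv n v ?v1"
    by (rule row_equiv_add[OF row_equiv.refl, where i = j and a = "t - 1"]) (use ijk y1_def in auto)
  have 2: "row_equiv n v ?v2"
    by (rule row_equiv_add[OF 1, where i = k and a = 1]) (use ijk x1_def in auto)
  have 3: "row_equiv n v ?v3"
    by (rule row_equiv_add[OF 2, where i = j and a = "b - 1"]) (use ijk y2_def in auto)
  have 4: "row_equiv n v ?v4"
    by (rule row_equiv_add[OF 3, where i = k and a = "- t"]) (use ijk x2_def in auto)
  have 5: "row_equiv n v (?v4(j := g))"
    by (rule row_equiv_add[OF 4, where i = i and a = "- ((b * h - g * u * ?f) * u)"])
      (use ijk x2 in \<open>auto simp: algebra_simps\<close>)
  have 6: "row_equiv n v (?v4(j := g, k := b * b * h))"
    by (rule row_equiv_add[OF 5, where i = i and a = "b * g * u"])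
      (use ijk y2 in \<open>auto simp: algebra_simps\<close>)
  moreover have "?v4(j := g, k := b * b * h) = v(j := g, k := b * b * h)"
    using ijk by (auto simp: fun_eq_iff)
  ultimately show ?thesis by simp
qed

lemma row_equiv_unit_vector:
  assumes n: "n \<ge> 2" and i: "i < n" "v i dvd 1" and k: "k < n"
  shows "\<exists>w. row_equiv n v w \<and> (\<forall>j<n. w j = (if j = k then 1 else 0))"
proof -
  have *: "\<exists>w. row_equiv n v w \<and> (\<forall>j<n. w j = (if j = k then 1 else 0))"
    if i: "i < n" "v i dvd 1" and ik: "i \<noteq> k" for v :: "nat \<Rightarrow> 'a" and i
  proof -
    from i(2) obtain u where u: "u * v i = 1" by (metis dvd_def mult.commute)
    let ?v = "v(k := 1)"
    have "1 = v k + ((1 - v k) * u) * v i" using u by (simp add: mult.assoc)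
    then have 1: "row_equiv n v ?v"
      by (intro row_equiv_add[OF row_equiv.refl, where i = i and a = "(1 - v k) * u"]) (use i ik k in auto)
    let ?J = "{..<n} - {k}"
    have "row_equiv n ?v (\<lambda>j. if j \<in> ?J then ?v j + (- v j) * ?v k else ?v j)"
      by (rule row_equiv_pivot) (use k in auto)
    with 1 have "row_equiv n v (\<lambda>j. if j \<in> ?J then ?v j + (- v j) * ?v k else ?v j)"
      by (rule row_equiv_trans)
    then show ?thesis using k by (intro exI conjI) (assumption, auto)
  qed
  show ?thesis
  proof (cases "i = k")
    case False
    with * i show ?thesis by blast
  next
    case True
    define j where "j = (if k = 0 then 1 else 0 :: nat)"
    have j: "j < n" "j \<noteq> k" using n by (auto simp: j_def)
    from i(2) obtain u where u: "u * v i = 1" by (metis dvd_def mult.commute)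
    have "1 = v j + ((1 - v j) * u) * v i" using u by (simp add: mult.assoc)
    then have 1: "row_equiv n v (v(j := 1))"
      by (intro row_equiv_add[OF row_equiv.refl, where i = i and a = "(1 - v j) * u"]) (use i j True in auto)
    have "\<exists>w. row_equiv n (v(j := 1)) w \<and> (\<forall>j<n. w j = (if j = k then 1 else 0))"
      by (rule *[of j]) (use j in auto)
    with 1 show ?thesis using row_equiv_trans by blast
  qed
qed

lemma unimodular_common_divisor:
  assumes "unimodular n v" "i < n" "\<And>j. j < n \<Longrightarrow> j \<noteq> i \<Longrightarrow> b dvd v j"
  shows "\<exists>u t. u * v i + t * b = 1"
proof -
  obtain u where u: "(\<Sum>j<n. u j * v j) = 1" using assms(1) by (auto simp: unimodular_def)
  have "b dvd (\<Sum>j\<in>{..<n} - {i}. u j * v j)"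
    using assms(3) by (intro dvd_sum dvd_mult) auto
  then obtain t where "(\<Sum>j\<in>{..<n} - {i}. u j * v j) = b * t" by (auto simp: dvd_def)
  then have "u i * v i + t * b = 1"
    using u assms(2) by (simp add: sum.remove[of _ i] mult.commute)
  then show ?thesis by blast
qed

text \<open>
  The induction is on a bound for the degree of an entry \<open>f\<close> with unit constant term.
  If the bound is \<open>e + 1\<close>, division from below brings all other entries to the form
  \<open>x^K g\<^sub>j\<close> with \<open>degree g\<^sub>j \<le> e\<close>. If they all vanish,
  \<open>f\<close> is a unit by unimodularity. Otherwise, if \<open>b\<close> is the common content
  of the \<open>g\<^sub>j\<close>, attained at \<open>j\<close>, then \<open>B = b x^K\<close>
  divides all entries other than \<open>f\<close>. By unimodularity \<open>B\<close> is comaximal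
  with \<open>f\<close>, so it can be moved from column \<open>j\<close> to a third column, and this
  is where \<open>n \<ge> 3\<close> enters. Column \<open>j\<close> is now primitive of degree at
  most \<open>e\<close>. The same device, with a power of \<open>x\<close> in place of
  \<open>B\<close>, gives it a unit constant term, and it takes over the role of \<open>f\<close>.
\<close>

lemma row_equiv_unit_entry:
  fixes v :: "nat \<Rightarrow> 'v::comm_ring_1 poly"
  assumes V: "valuation_ring TYPE('v)" and n: "n \<ge> 3"
  shows "unimodular n v \<Longrightarrow> i < n \<Longrightarrow> coeff (v i) 0 dvd 1 \<Longrightarrow> degree (v i) \<le> d \<Longrightarrow>
    \<exists>w j. row_equiv n v w \<and> j < n \<and> w j dvd 1"
proof (induction d arbitrary: v i)
  case 0
  from 0(3) have "[:coeff (v i) 0:] dvd 1" by (rule unit_constant_poly)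
  moreover have "v i = [:coeff (v i) 0:]" using 0(4) degree_0_id[of "v i"] by simp
  ultimately show ?case using 0(2) row_equiv.refl by metis
next
  case (Suc e)
  let ?f = "v i" let ?J = "{..<n} - {i}"
  define K where "K = (\<Sum>j<n. degree (v j))"
  have K: "degree (v j) \<le> K" if "j < n" for j
    unfolding K_def using that by (intro member_le_sum) auto
  have "\<exists>c h. v j = c * ?f + monom 1 K * h \<and> (j < n \<longrightarrow> degree h \<le> e)" for j
  proof -
    from divide_from_below[OF Suc.prems(3), of "v j" K] obtain c h where
      "v j = c * ?f + monom 1 K * h" "degree h \<le> max (degree ?f - 1) (degree (v j) - K)" by blast
    then show ?thesis using K[of j] Suc.prems(4) by (intro exI[of _ c] exI[of _ h]) auto
  qed
  then obtain c g where cg: "v j = c j * ?f + monom 1 K * g j" "j < n \<Longrightarrow> degree (g j) \<le> e" for j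
    by metis
  define v1 where "v1 j = (if j \<in> ?J then v j + (- c j) * ?f else v j)" for j
  have v1: "row_equiv n v v1" unfolding v1_def
    by (rule row_equiv_pivot) (use Suc.prems in auto)
  have v1i: "v1 i = ?f" by (simp add: v1_def)
  have v1j: "v1 j = monom 1 K * g j" if "j \<in> ?J" for j
    using that cg(1)[of j] unfolding v1_def by (simp add: algebra_simps)
  have uni1: "unimodular n v1" using unimodular_row_equiv[OF v1 Suc.prems(1)] .
  show ?case
  proof (cases "\<forall>j\<in>?J. g j = 0")
    case True
    then have "\<exists>u t. u * v1 i + t * 0 = 1"
      by (intro unimodular_common_divisor[OF uni1 Suc.prems(2)]) (use v1j in auto)
    then have "v1 i dvd 1" by (metis add.right_neutral dvd_triv_right mult_zero_right)
    with v1 Suc.prems(2) show ?thesis by blast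
  next
    case False
    let ?S = "(\<lambda>(j, l). coeff (g j) l) ` {(j, l). j \<in> ?J \<and> l \<le> e \<and> coeff (g j) l \<noteq> 0}"
    have "finite {(j, l). j \<in> ?J \<and> l \<le> e \<and> coeff (g j) l \<noteq> 0}"
      by (rule finite_subset[of _ "?J \<times> {..e}"]) auto
    then have finS: "finite ?S" by blast
    have inS: "coeff (g j) l \<in> ?S" if "j \<in> ?J" "coeff (g j) l \<noteq> 0" for j l
    proof -
      have "l \<le> e" using le_degree[OF that(2)] cg(2)[of j] that(1) by auto
      with that show ?thesis by auto
    qed
    from False obtain j' where "j' \<in> ?J" "g j' \<noteq> 0" by blast
    then have "?S \<noteq> {}" using inS[of j' "degree (g j')"] leading_coeff_0_iff by blast
    from finite_ex_least_dvd[OF V finS this] obtain b where b: "b \<in> ?S" "\<forall>s\<in>?S. b dvd s" by blast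
    have bdvd: "b dvd coeff (g j) l" if "j \<in> ?J" for j l
      using b(2) inS[OF that, of l] by (cases "coeff (g j) l = 0") auto
    from b(1) obtain j l where j: "j \<in> ?J" and l: "coeff (g j) l = b" and b0: "b \<noteq> 0" by auto
    have "\<exists>h. m \<in> ?J \<longrightarrow> g m = smult b h \<and> degree h \<le> e \<and>
        (\<forall>r. coeff (g m) r = b \<longrightarrow> b \<noteq> 0 \<longrightarrow> coeff h r = 1)" for m
    proof (cases "m \<in> ?J")
      case True
      from smult_of_dvd_coeffs[OF bdvd[OF True]] obtain h where
        h: "g m = smult b h" "degree h \<le> degree (g m)"
           "\<forall>r. coeff (g m) r = b \<longrightarrow> b \<noteq> 0 \<longrightarrow> coeff h r = 1" by blast
      have "degree h \<le> e" using h(2) cg(2)[of m] True by simp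
      with h(1,3) have "g m = smult b h \<and> degree h \<le> e \<and>
        (\<forall>r. coeff (g m) r = b \<longrightarrow> b \<noteq> 0 \<longrightarrow> coeff h r = 1)" by (intro conjI)
      then show ?thesis by (intro exI impI)
    qed blast
    then obtain h where h: "g m = smult b (h m)" "degree (h m) \<le> e"
        "coeff (g m) r = b \<Longrightarrow> b \<noteq> 0 \<Longrightarrow> coeff (h m) r = 1" if "m \<in> ?J" for m r
      by metis
    define B where "B = monom b K"
    have v1B: "v1 m = B * h m" if "m \<in> ?J" for m
      using v1j[OF that] h(1)[OF that] by (simp add: B_def smult_monom flip: mult_smult_left)
    have "\<exists>u t. u * v1 i + t * B = 1"
      by (intro unimodular_common_divisor[OF uni1 Suc.prems(2)]) (use v1B in auto)
    then obtain u t where ut: "u * v1 i + t * B = 1" by blast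
    have "card ({..<n} - {i, j}) \<ge> 1"
      using n Suc.prems(2) j by (subst card_Diff_subset) auto
    then obtain k where k: "k \<in> ?J" "k \<noteq> j" by (metis Diff_iff card.empty ex_in_conv insert_iff not_one_le_zero)
    have ijk: "i < n" "j < n" "k < n" "i \<noteq> j" "i \<noteq> k" "j \<noteq> k" using Suc.prems(2) j k by auto
    define v2 where "v2 = v1(j := h j, k := B * B * h k)"
    have v2: "row_equiv n v1 v2" unfolding v2_def
      by (rule row_equiv_move_factor[where v = v1 and i = i and u = u and t = t, OF ijk]) (use v1B j k ut in auto)
    have v2i: "v2 i = ?f" using ijk v1i by (simp add: v2_def)
    have "coeff (h j) l dvd 1" using h(3)[OF j l b0] by simp
    \<comment> \<open>Both columns receive the factor \<open>x^m\<close>, so that it can be moved away from column \<open>j\<close>.\<close>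
    from divide_to_unit_constant_term[OF V Suc.prems(3,4) this h(2)[OF j]] obtain c1 m p where
      p: "h j = c1 * ?f + monom 1 m * p" "coeff p 0 dvd 1" "degree p \<le> e" by blast
    from divide_from_below[OF Suc.prems(3)] obtain c2 q where
      q: "B * B * h k = c2 * ?f + monom 1 m * q" by blast
    define v3 where "v3 = v2(j := monom 1 m * p, k := monom 1 m * q)"
    have "row_equiv n v2 (v2(j := monom 1 m * p))"
      by (rule row_equiv_add[OF row_equiv.refl, where i = i and a = "- c1"])
        (use ijk v2i p(1) in \<open>auto simp: v2_def algebra_simps\<close>)
    then have v3: "row_equiv n v2 v3" unfolding v3_def
      by (rule row_equiv_add[where i = i and a = "- c2"])
        (use ijk v2i q in \<open>auto simp: v2_def algebra_simps\<close>)
    from comaximal_monom[OF Suc.prems(3)] obtain u' t' where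
      ut': "u' * ?f + t' * monom 1 m = 1" by blast
    define v4 where "v4 = v3(j := p, k := monom 1 m * monom 1 m * q)"
    have v4: "row_equiv n v3 v4" unfolding v4_def
      by (rule row_equiv_move_factor[where v = v3 and i = i and u = u' and t = t', OF ijk])
        (use ut' v2i ijk in \<open>auto simp: v3_def\<close>)
    have equiv: "row_equiv n v v4" using v1 v2 v3 v4 row_equiv_trans by blast
    have v4j: "v4 j = p" using ijk by (simp add: v4_def)
    have "\<exists>w j. row_equiv n v4 w \<and> j < n \<and> w j dvd 1"
      by (rule Suc.IH[OF unimodular_row_equiv[OF equiv Suc.prems(1)] ijk(2)])
        (use p v4j in auto)
    with equiv show ?thesis using row_equiv_trans by blast
  qed
qed

text \<open>
  Since the ring of coefficients is local, the constant terms of a unimodular row cannot all be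
  nonunits; this starts the degree reduction.
\<close>

lemma unimodular_row_equiv_unit_vector:
  fixes v :: "nat \<Rightarrow> 'v::comm_ring_1 poly"
  assumes V: "valuation_ring TYPE('v)" and n: "n \<ge> 3" and v: "unimodular n v" and k: "k < n"
  shows "\<exists>w. row_equiv n v w \<and> (\<forall>j<n. w j = (if j = k then 1 else 0))"
proof -
  obtain u where "(\<Sum>i<n. u i * v i) = 1" using v by (auto simp: unimodular_def)
  from arg_cong[OF this, of "\<lambda>p. coeff p 0"]
  have "(\<Sum>i<n. coeff (u i) 0 * coeff (v i) 0) dvd 1" by (simp add: coeff_sum coeff_mult)
  from dvd_one_sum[OF V this] obtain i where i: "i < n" "coeff (v i) 0 dvd 1"
    using dvd_mult_right by blast
  from row_equiv_unit_entry[OF V n v i order_refl] obtain w j where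
    w: "row_equiv n v w" "j < n" "w j dvd 1" by blast
  have "n \<ge> 2" using n by simp
  from row_equiv_unit_vector[where v = w, OF this w(2,3) k] w(1) show ?thesis using row_equiv_trans by blast
qed

section \<open>Elementary matrices\<close>

lemma SL_mult: "A \<in> carrier (SL n) \<Longrightarrow> B \<in> carrier (SL n) \<Longrightarrow> A * B \<in> carrier (SL n)"
  by (auto simp: det_mult[of _ n])

lemma E_subset: "E n \<subseteq> carrier (SL n)"
  using subgroup.subset[OF subgroup_E] .

lemma E_carrier: "A \<in> E n \<Longrightarrow> A \<in> carrier_mat n n"
  using E_subset by fastforce

lemma E_mult: "A \<in> E n \<Longrightarrow> B \<in> E n \<Longrightarrow> A * B \<in> E n"
  using subgroup.m_closed[OF subgroup_E, of A n B] by simp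

lemma E_one: "1\<^sub>m n \<in> E n"
  using subgroup.one_closed[OF subgroup_E, of n] by simp

lemma E_inverse:
  assumes "P \<in> E n"
  shows "\<exists>Q\<in>E n. Q * P = 1\<^sub>m n \<and> P * Q = 1\<^sub>m n"
proof -
  interpret group "SL n" by (rule group_SL)
  have P: "P \<in> carrier (SL n)" using assms E_subset by blast
  have "inv\<^bsub>SL n\<^esub> P \<in> E n" using subgroup.m_inv_closed[OF subgroup_E assms] .
  with l_inv[OF P] r_inv[OF P] show ?thesis by auto
qed

lemma addrow_mat_in_E: "i < n \<Longrightarrow> j < n \<Longrightarrow> i \<noteq> j \<Longrightarrow> addrow_mat n a i j \<in> E n"
  unfolding E_def by (rule generate.incl) (auto simp: elementary_mats_def)

lemma E_cancel_left:
  assumes P: "P \<in> E n" and A: "A \<in> carrier_mat n n" and PA: "P * A \<in> E n"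
  shows "A \<in> E n"
proof -
  obtain Q where Q: "Q \<in> E n" "Q * P = 1\<^sub>m n" using E_inverse[OF P] by blast
  have "Q * (P * A) = A"
    using assoc_mult_mat[OF E_carrier[OF Q(1)] E_carrier[OF P] A] Q(2) A by simp
  with E_mult[OF Q(1) PA] show ?thesis by simp
qed

lemma E_cancel_right:
  assumes P: "P \<in> E n" and A: "A \<in> carrier_mat n n" and AP: "A * P \<in> E n"
  shows "A \<in> E n"
proof -
  obtain Q where Q: "Q \<in> E n" "P * Q = 1\<^sub>m n" using E_inverse[OF P] by blast
  have "(A * P) * Q = A"
    using assoc_mult_mat[OF A E_carrier[OF P] E_carrier[OF Q(1)]] Q(2) A by simp
  with E_mult[OF AP Q(1)] show ?thesis by simp
qed

lemma addrow_in_E_iff: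
  assumes "A \<in> carrier_mat n n" "i < n" "j < n" "i \<noteq> j"
  shows "addrow a i j A \<in> E n \<longleftrightarrow> A \<in> E n"
  using addrow_mat[OF assms(1,3), of a i] addrow_mat_in_E[OF assms(2-4), of a]
    E_cancel_left[OF _ assms(1)] E_mult by metis

lemma addcol_in_E_iff:
  assumes "A \<in> carrier_mat n n" "i < n" "j < n" "i \<noteq> j"
  shows "addcol a i j A \<in> E n \<longleftrightarrow> A \<in> E n"
  using addcol_mat[OF assms(1,3), of a i] addrow_mat_in_E[OF assms(3,2), of a]
    E_cancel_right[OF _ assms(1)] E_mult assms(4) by metis

lemma row_equiv_realised_in_E:
  assumes A: "A \<in> carrier_mat n n" and r: "r < n"
    and "row_equiv n (\<lambda>j. A $$ (r, j)) w"
  shows "\<exists>P\<in>E n. \<forall>j<n. (A * P) $$ (r, j) = w j"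
  using assms(3)
proof induction
  case refl
  show ?case using E_one A by (intro bexI[of _ "1\<^sub>m n"]) auto
next
  case (step w i j a)
  then obtain P where P: "P \<in> E n" "\<forall>j<n. (A * P) $$ (r, j) = w j" by blast
  let ?R = "addrow_mat n a i j"
  have AP: "A * P \<in> carrier_mat n n" using A E_carrier[OF P(1)] by simp
  have "A * (P * ?R) = (A * P) * ?R"
    using assoc_mult_mat[OF A E_carrier[OF P(1)] addrow_mat_carrier] by simp
  also have "\<dots> = addcol a j i (A * P)" using addcol_mat[OF AP \<open>i < n\<close>, of a j] by simp
  finally have APR: "A * (P * ?R) = addcol a j i (A * P)" .
  have "addcol a j i B $$ (r, k) = (w(j := w j + a * w i)) k"
    if "B \<in> carrier_mat n n" "\<forall>j<n. B $$ (r, j) = w j" "k < n" for B k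
    using that r step.hyps by auto
  from this[OF AP P(2)] have "\<forall>k<n. (A * (P * ?R)) $$ (r, k) = (w(j := w j + a * w i)) k"
    unfolding APR by blast
  with E_mult[OF P(1) addrow_mat_in_E[OF step.hyps(2-4)]] show ?case by blast
qed

section \<open>Two by two blocks inside three by three matrices\<close>

definition mat3 :: "'a \<Rightarrow> 'a \<Rightarrow> 'a \<Rightarrow> 'a \<Rightarrow> 'a \<Rightarrow> 'a \<Rightarrow> 'a \<Rightarrow> 'a \<Rightarrow> 'a \<Rightarrow> 'a mat" where
  "mat3 a b c d e f g h i = mat_of_rows_list 3 [[a, b, c], [d, e, f], [g, h, i]]"

lemma mat3_carrier: "mat3 a b c d e f g h i \<in> carrier_mat 3 3"
  by (simp add: mat3_def mat_of_rows_list_def numeral_3_eq_3)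

lemma mat3_addrow:
  fixes a b c d e f g h i x :: "'a::comm_ring_1"
  shows "addrow x 0 1 (mat3 a b c d e f g h i) = mat3 (a + x * d) (b + x * e) (c + x * f) d e f g h i"
    and "addrow x 0 2 (mat3 a b c d e f g h i) = mat3 (a + x * g) (b + x * h) (c + x * i) d e f g h i"
    and "addrow x 1 0 (mat3 a b c d e f g h i) = mat3 a b c (d + x * a) (e + x * b) (f + x * c) g h i"
    and "addrow x 1 2 (mat3 a b c d e f g h i) = mat3 a b c (d + x * g) (e + x * h) (f + x * i) g h i"
    and "addrow x 2 0 (mat3 a b c d e f g h i) = mat3 a b c d e f (g + x * a) (h + x * b) (i + x * c)"
    and "addrow x 2 1 (mat3 a b c d e f g h i) = mat3 a b c d e f (g + x * d) (h + x * e) (i + x * f)"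
  by (auto simp: mat3_def mat_of_rows_list_def numeral_3_eq_3 less_Suc_eq nth_Cons' intro!: eq_matI)

lemma mat3_addcol:
  fixes a b c d e f g h i x :: "'a::comm_ring_1"
  shows "addcol x 0 1 (mat3 a b c d e f g h i) = mat3 (a + x * b) b c (d + x * e) e f (g + x * h) h i"
    and "addcol x 0 2 (mat3 a b c d e f g h i) = mat3 (a + x * c) b c (d + x * f) e f (g + x * i) h i"
    and "addcol x 1 0 (mat3 a b c d e f g h i) = mat3 a (b + x * a) c d (e + x * d) f g (h + x * g) i"
    and "addcol x 1 2 (mat3 a b c d e f g h i) = mat3 a (b + x * c) c d (e + x * f) f g (h + x * i) i"
    and "addcol x 2 0 (mat3 a b c d e f g h i) = mat3 a b (c + x * a) d e (f + x * d) g h (i + x * g)"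
    and "addcol x 2 1 (mat3 a b c d e f g h i) = mat3 a b (c + x * b) d e (f + x * e) g h (i + x * h)"
  by (auto simp: mat3_def mat_of_rows_list_def numeral_3_eq_3 less_Suc_eq nth_Cons' intro!: eq_matI)


text \<open>
  Conjugation by the rotation of the first and the third coordinate; the rotation is a product of
  three elementary matrices.
\<close>

lemma mat3_rotate:
  fixes f y z s :: "'a::comm_ring_1"
  shows "mat3 1 0 0 0 s y 0 z f \<in> E 3 \<longleftrightarrow> mat3 f z 0 y s 0 0 0 1 \<in> E 3"
proof -
  have "mat3 1 0 0 0 s y 0 z f \<in> E 3 \<longleftrightarrow> mat3 1 z f 0 s y 0 z f \<in> E 3"
    using addrow_in_E_iff[OF mat3_carrier, of 0 2 1 1 0 0 0 s y 0 z f] by (simp add: mat3_addrow del: One_nat_def)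
  also have "\<dots> \<longleftrightarrow> mat3 1 z f 0 s y (-1) 0 0 \<in> E 3"
    using addrow_in_E_iff[OF mat3_carrier, of 2 0 "-1" 1 z f 0 s y 0 z f] by (simp add: mat3_addrow del: One_nat_def)
  also have "\<dots> \<longleftrightarrow> mat3 0 z f 0 s y (-1) 0 0 \<in> E 3"
    using addrow_in_E_iff[OF mat3_carrier, of 0 2 1 1 z f 0 s y "-1" 0 0] by (simp add: mat3_addrow del: One_nat_def)
  also have "\<dots> \<longleftrightarrow> mat3 f z f y s y (-1) 0 0 \<in> E 3"
    using addcol_in_E_iff[OF mat3_carrier, of 0 2 1 0 z f 0 s y "-1" 0 0] by (simp add: mat3_addcol del: One_nat_def)
  also have "\<dots> \<longleftrightarrow> mat3 f z 0 y s 0 (-1) 0 1 \<in> E 3"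
    using addcol_in_E_iff[OF mat3_carrier, of 2 0 "-1" f z f y s y "-1" 0 0] by (simp add: mat3_addcol del: One_nat_def)
  also have "\<dots> \<longleftrightarrow> mat3 f z 0 y s 0 0 0 1 \<in> E 3"
    using addcol_in_E_iff[OF mat3_carrier, of 0 2 1 f z 0 y s 0 "-1" 0 1] by (simp add: mat3_addcol del: One_nat_def)
  finally show ?thesis .
qed

text \<open>
  The factor \<open>b\<close> passes from one off-diagonal entry to the other. Both sides are
  obtained from the matrix with rows \<open>(1, 0, -b)\<close>, \<open>(v, s, 0)\<close>,
  \<open>(g, w, 1)\<close>, by clearing with the pivot in the last corner or with the pivot in the
  first corner. It is the stable equivalence of \<open>1 + X Y\<close> and \<open>1 + Y X\<close>,
  for which the third coordinate gives just enough room.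
\<close>

lemma mat3_move_factor:
  fixes f g b w v s :: "'a::comm_ring_1"
  assumes f: "f = 1 + b * g"
  shows "mat3 f (b * w) 0 v s 0 0 0 1 \<in> E 3 \<longleftrightarrow> mat3 f w 0 (b * v) s 0 0 0 1 \<in> E 3"
proof -
  have "mat3 f (b * w) 0 v s 0 0 0 1 \<in> E 3 \<longleftrightarrow> mat3 f (b * w) 0 v s 0 g 0 1 \<in> E 3"
    using addcol_in_E_iff[OF mat3_carrier, of 0 2 g f "b * w" 0 v s 0 0 0 1] by (simp add: mat3_addcol del: One_nat_def)
  also have "\<dots> \<longleftrightarrow> mat3 f (b * w) 0 v s 0 g w 1 \<in> E 3"
    using addcol_in_E_iff[OF mat3_carrier, of 1 2 w f "b * w" 0 v s 0 g 0 1] by (simp add: mat3_addcol del: One_nat_def)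
  also have "\<dots> \<longleftrightarrow> mat3 1 0 (-b) v s 0 g w 1 \<in> E 3"
    using addrow_in_E_iff[OF mat3_carrier, of 0 2 "-b" f "b * w" 0 v s 0 g w 1] f by (simp add: mat3_addrow del: One_nat_def)
  also have "\<dots> \<longleftrightarrow> mat3 1 0 (-b) 0 s (b * v) g w 1 \<in> E 3"
    using addrow_in_E_iff[OF mat3_carrier, of 1 0 "-v" 1 0 "-b" v s 0 g w 1]
    by (simp add: mat3_addrow mult.commute del: One_nat_def)
  also have "\<dots> \<longleftrightarrow> mat3 1 0 (-b) 0 s (b * v) 0 w f \<in> E 3"
    using addrow_in_E_iff[OF mat3_carrier, of 2 0 "-g" 1 0 "-b" 0 s "b * v" g w 1] f
    by (simp add: mat3_addrow mult.commute del: One_nat_def)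
  also have "\<dots> \<longleftrightarrow> mat3 1 0 0 0 s (b * v) 0 w f \<in> E 3"
    using addcol_in_E_iff[OF mat3_carrier, of 2 0 b 1 0 "-b" 0 s "b * v" 0 w f] by (simp add: mat3_addcol del: One_nat_def)
  also have "\<dots> \<longleftrightarrow> mat3 f w 0 (b * v) s 0 0 0 1 \<in> E 3"
    by (rule mat3_rotate)
  finally show ?thesis .
qed

text \<open>
  This says that the Mennicke symbol of \<open>(p, q)\<close> is trivial: every completion of the
  row to a matrix of determinant \<open>1\<close> becomes elementary in size three.
\<close>

definition sl2_elementary :: "'a::comm_ring_1 \<Rightarrow> 'a \<Rightarrow> bool" where
  "sl2_elementary p q \<longleftrightarrow> (\<forall>r s. p * s - q * r = 1 \<longrightarrow> mat3 p q 0 r s 0 0 0 1 \<in> E 3)"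

lemma sl2_elementary_add_right:
  assumes "sl2_elementary p (q + c * p)"
  shows "sl2_elementary p q"
  unfolding sl2_elementary_def
proof (intro allI impI)
  fix r s assume "p * s - q * r = 1"
  then have "p * (s + c * r) - (q + c * p) * r = 1" by (simp add: algebra_simps)
  with assms have "mat3 p (q + c * p) 0 r (s + c * r) 0 0 0 1 \<in> E 3"
    unfolding sl2_elementary_def by blast
  then show "mat3 p q 0 r s 0 0 0 1 \<in> E 3"
    using addcol_in_E_iff[OF mat3_carrier, of 1 0 c p q 0 r s 0 0 0 1] by (simp add: mat3_addcol del: One_nat_def)
qed

lemma sl2_elementary_add_left:
  assumes "sl2_elementary (p + c * q) q"
  shows "sl2_elementary p q"
  unfolding sl2_elementary_def
proof (intro allI impI)
  fix r s assume "p * s - q * r = 1"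
  then have "(p + c * q) * s - q * (r + c * s) = 1" by (simp add: algebra_simps)
  with assms have "mat3 (p + c * q) q 0 (r + c * s) s 0 0 0 1 \<in> E 3"
    unfolding sl2_elementary_def by blast
  then show "mat3 p q 0 r s 0 0 0 1 \<in> E 3"
    using addcol_in_E_iff[OF mat3_carrier, of 0 1 c p q 0 r s 0 0 0 1] by (simp add: mat3_addcol del: One_nat_def)
qed

lemma sl2_elementary_drop_factor_one:
  assumes p: "p = 1 + b * g" and "sl2_elementary p q"
  shows "sl2_elementary p (b * q)"
  unfolding sl2_elementary_def
proof (intro allI impI)
  fix r s assume "p * s - b * q * r = 1"
  then have "p * s - q * (b * r) = 1" by (simp add: algebra_simps)
  with assms(2) have "mat3 p q 0 (b * r) s 0 0 0 1 \<in> E 3"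
    unfolding sl2_elementary_def by blast
  then show "mat3 p (b * q) 0 r s 0 0 0 1 \<in> E 3"
    using mat3_move_factor[OF p, of q r s] by simp
qed

lemma sl2_elementary_rotate:
  assumes "sl2_elementary q (- p)"
  shows "sl2_elementary p q"
proof -
  have "sl2_elementary (p + q) (- p)"
    by (rule sl2_elementary_add_left[where c = 1]) (use assms in simp)
  then have "sl2_elementary (p + q) (q + (- 1) * (p + q))" by simp
  then have "sl2_elementary (p + q) q" by (rule sl2_elementary_add_right)
  then have "sl2_elementary (p + 1 * q) q" by simp
  then show ?thesis by (rule sl2_elementary_add_left)
qed

lemma sl2_elementary_unit_right:
  assumes u: "u dvd 1" and "sl2_elementary p q"
  shows "sl2_elementary p (u * q)"
proof -
  from u have "u dvd p - 1" by (rule dvd_trans) simp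
  then obtain g where "p - 1 = u * g" by (auto simp: dvd_def)
  then have "p = 1 + u * g" by (metis add.commute diff_add_cancel)
  from sl2_elementary_drop_factor_one[OF this assms(2)] show ?thesis .
qed

lemma sl2_elementary_swap:
  assumes "sl2_elementary q p"
  shows "sl2_elementary p q"
proof (rule sl2_elementary_rotate)
  show "sl2_elementary q (- p)"
    using sl2_elementary_unit_right[of "-1", OF _ assms] by simp
qed

lemma sl2_elementary_unit_left:
  assumes u: "u dvd 1" and "sl2_elementary p q"
  shows "sl2_elementary (u * p) q"
  by (rule sl2_elementary_swap, rule sl2_elementary_unit_right[OF u], rule sl2_elementary_swap)
    (rule assms(2))

text \<open>
  Multiplicativity of the Mennicke symbol in the case where \<open>p\<close> is congruent to a unit
  modulo the factor.
\<close>

lemma sl2_elementary_drop_factor: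
  assumes u: "u dvd 1" and p: "p = u + b * g" and S: "sl2_elementary p q"
  shows "sl2_elementary p (b * q)"
proof -
  from u obtain u' where u': "u' * u = 1" by (metis dvd_def mult.commute)
  then have "u' dvd 1" by (metis dvd_triv_left)
  with S have "sl2_elementary (u' * p) q" by (rule sl2_elementary_unit_left[rotated])
  moreover have "u' * p = 1 + b * (u' * g)" using u' p by (simp add: distrib_left mult.left_commute)
  ultimately have "sl2_elementary (u' * p) (b * q)" by (rule sl2_elementary_drop_factor_one[rotated])
  with u have "sl2_elementary (u * (u' * p)) (b * q)" by (rule sl2_elementary_unit_left)
  moreover have "u * (u' * p) = (u' * u) * p" by (simp only: ac_simps)
  ultimately show ?thesis using u' by simp
qed

text \<open>
  The row \<open>(p, q)\<close> is turned into \<open>(p, 1)\<close>, then \<open>(1, 1)\<close>,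
  then \<open>(1, 0)\<close>.
\<close>

lemma sl2_elementary_unit:
  assumes "p dvd 1"
  shows "sl2_elementary p q"
proof -
  from assms have "p dvd 1 - q" by (rule dvd_trans) simp
  then obtain c where c: "1 - q = p * c" by (auto simp: dvd_def)
  have "sl2_elementary (1 :: 'a) 0"
    unfolding sl2_elementary_def
  proof (intro allI impI)
    fix r s :: 'a assume "1 * s - 0 * r = 1"
    then have s: "s = 1" by simp
    have "mat3 1 0 0 0 1 0 0 0 1 = (1\<^sub>m 3 :: 'a mat)"
      by (auto simp: mat3_def mat_of_rows_list_def numeral_3_eq_3 less_Suc_eq nth_Cons' intro!: eq_matI)
    then have "mat3 1 0 0 0 1 0 0 0 1 \<in> (E 3 :: 'a mat set)" using E_one by metis
    then show "mat3 1 0 0 r s 0 0 0 1 \<in> E 3"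
      using addrow_in_E_iff[OF mat3_carrier, of 1 0 r 1 0 0 0 1 0 0 0 1] s by (simp add: mat3_addrow del: One_nat_def)
  qed
  then have "sl2_elementary (1 :: 'a) (1 + (- 1) * 1)" by simp
  then have "sl2_elementary (1 :: 'a) 1" by (rule sl2_elementary_add_right)
  then have "sl2_elementary (p + (1 - p) * 1) 1" by simp
  then have "sl2_elementary p 1" by (rule sl2_elementary_add_left)
  moreover have "q + c * p = 1" using c by (metis add.commute diff_add_cancel mult.commute)
  ultimately have "sl2_elementary p (q + c * p)" by simp
  then show ?thesis by (rule sl2_elementary_add_right)
qed

section \<open>Completions of rows of length two over a valuation ring\<close>

text \<open>
  Here \<open>p\<close> is congruent to a unit only modulo \<open>a\<close>, and some power of
  \<open>a\<close> is divisible by \<open>b\<close>. If \<open>b\<close> divides \<open>a\<close>,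
  the previous rule applies. Otherwise \<open>b = a b'\<close>, the factor \<open>a\<close> can be
  removed, and \<open>b'\<close> divides a smaller power of \<open>a\<close>. The last claim takes
  an argument because \<open>a\<close> cannot be cancelled.
\<close>

lemma sl2_elementary_drop_nilpotent_factor:
  fixes p q t :: "'v::comm_ring_1 poly"
  assumes V: "valuation_ring TYPE('v)"
    and u: "u dvd 1" and p: "p = u + [:a:] * t" and S: "sl2_elementary p q"
  shows "b dvd a ^ k \<Longrightarrow> b \<noteq> 0 \<Longrightarrow> sl2_elementary p ([:b:] * q)"
proof (induction k arbitrary: b)
  case 0
  then have "[:b:] dvd 1" by (simp add: unit_constant_poly)
  with S show ?case by (rule sl2_elementary_unit_right[rotated])
next
  case (Suc k)
  from valuation_dvd_total[OF V, of b a] show ?case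
  proof
    assume "b dvd a"
    then obtain d where "a = b * d" by (auto simp: dvd_def)
    then have "p = u + [:b:] * ([:d:] * t)" using p by (simp add: mult.commute)
    with u show ?thesis using S by (rule sl2_elementary_drop_factor)
  next
    assume "a dvd b"
    then obtain b' where b': "b = a * b'" by (auto simp: dvd_def)
    have "b' dvd a ^ k"
    proof -
      from valuation_dvd_total[OF V, of b' "a ^ k"] show ?thesis
      proof
        \<comment> \<open>Then \<open>b = b (c e)\<close> with \<open>c e\<close> or \<open>1 - c e\<close> a unit; the latter would give \<open>b = 0\<close>.\<close>
        assume "a ^ k dvd b'"
        then obtain e where e: "b' = a ^ k * e" by (auto simp: dvd_def)
        from Suc.prems(1) obtain c where c: "a ^ Suc k = b * c" by (auto simp: dvd_def)
        have "b * (c * e) = a ^ Suc k * e" by (simp only: c mult.assoc)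
        also have "\<dots> = b" using b' e by (simp add: mult.assoc)
        finally have b1: "b * (1 - c * e) = 0" by (simp add: right_diff_distrib)
        have "c * e + (1 - c * e) dvd 1" by simp
        from dvd_one_add[OF V this] show ?thesis
        proof
          assume "c * e dvd 1"
          then have "e dvd 1" by (rule dvd_mult_right)
          then have "a ^ k * e dvd a ^ k * 1" by (rule mult_dvd_mono[OF dvd_refl])
          with e show ?thesis by simp
        next
          assume "1 - c * e dvd 1"
          then obtain z where "(1 - c * e) * z = 1" by (auto simp: dvd_def)
          then have "b = b * (1 - c * e) * z" by (simp add: mult.assoc)
          with b1 Suc.prems(2) show ?thesis by simp
        qed
      qed
    qed
    moreover have "b' \<noteq> 0" using b' Suc.prems(2) by auto
    ultimately have "sl2_elementary p ([:b':] * q)" by (rule Suc.IH)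
    with u p have "sl2_elementary p ([:a:] * ([:b':] * q))" by (rule sl2_elementary_drop_factor)
    then show ?thesis using b' by (simp add: mult.commute)
  qed
qed

text \<open>
  A constant \<open>b\<close> comaximal with \<open>p\<close> makes all coefficients of
  \<open>p\<close> other than the constant one nilpotent modulo \<open>b\<close>, hence also the
  content \<open>a\<close> of \<open>p - p(0)\<close>, which is one of them.
\<close>

lemma sl2_elementary_drop_constant_factor:
  fixes p q :: "'v::comm_ring_1 poly"
  assumes V: "valuation_ring TYPE('v)" and p0: "coeff p 0 dvd 1"
    and us: "u * p + s * [:b:] = 1" and S: "sl2_elementary p q"
  shows "sl2_elementary p ([:b:] * q)"
proof -
  from split_constant_term[of p] obtain t where
    t: "p = [:coeff p 0:] + monom 1 1 * t" "\<And>i. coeff p (Suc i) = coeff t i" by (elim exE conjE) blast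
  note u = unit_constant_poly[OF p0]
  show ?thesis
  proof (cases "t = 0 \<or> b = 0")
    case True
    then have "p dvd 1"
    proof
      assume "t = 0"
      with t(1) have "[:coeff p 0:] = p" by simp
      with u show ?thesis by metis
    next
      assume "b = 0"
      with us show ?thesis by (metis add.right_neutral dvd_triv_right mult_zero_right pCons_0_0)
    qed
    then show ?thesis by (rule sl2_elementary_unit)
  next
    case False
    then have "t \<noteq> 0" by simp
    from ex_smult_content[OF V this] obtain a g i where a: "t = smult a g" "a = coeff t i"
      by (elim exE conjE) (rule that)
    have "coeff p (Suc i) = a" using t(2)[of i] a(2) by (rule trans[OF _ sym])
    then obtain k where "b dvd a ^ k"
      using nilpotent_coeffs_of_unit_mod[OF V us, of "Suc i"] by auto
    moreover have "p = [:coeff p 0:] + [:a:] * (monom 1 1 * g)"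
      by (subst t(1), subst a(1)) simp
    ultimately show ?thesis
      using sl2_elementary_drop_nilpotent_factor[OF V u _ S] False by blast
  qed
qed

text \<open>
  A polynomial is congruent to its constant term modulo \<open>x\<close>, so powers of
  \<open>x\<close> are removed one factor at a time.
\<close>

lemma sl2_elementary_drop_monom:
  fixes p q :: "'a::comm_ring_1 poly"
  assumes p0: "coeff p 0 dvd 1" and S: "sl2_elementary p q"
  shows "sl2_elementary p (monom 1 k * q)"
proof (induction k)
  case 0
  then show ?case using S by simp
next
  case (Suc k)
  from split_constant_term[of p] obtain t where t: "p = [:coeff p 0:] + monom 1 1 * t"
    by (elim exE conjE) (rule that)
  from sl2_elementary_drop_factor[OF unit_constant_poly[OF p0] t Suc.IH]
  show ?case by (simp add: mult_monom flip: mult.assoc)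
qed

text \<open>
  The same descent on the degree of \<open>p\<close> as for longer rows: \<open>q\<close> is divided
  by \<open>p\<close> from below, freed of the power of \<open>x\<close> and of its content, brought
  to a unit constant term, and exchanged with \<open>p\<close>.
\<close>

lemma sl2_elementary_of_unit_constant_term:
  fixes p q :: "'v::comm_ring_1 poly"
  assumes V: "valuation_ring TYPE('v)"
  shows "coeff p 0 dvd 1 \<Longrightarrow> degree p \<le> d \<Longrightarrow> p * s - q * r = 1 \<Longrightarrow> sl2_elementary p q"
proof (induction d arbitrary: p q r s)
  case 0
  have "[:coeff p 0:] = p" using 0(2) degree_0_id[of p] by simp
  then have "p dvd 1" using unit_constant_poly[OF 0(1)] by metis
  then show ?case by (rule sl2_elementary_unit)
next
  case (Suc e)
  from divide_from_below[OF Suc.prems(1), of q "degree q"] obtain c g where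
    g: "q = c * p + monom 1 (degree q) * g" "degree g \<le> max (degree p - 1) (degree q - degree q)"
    by blast
  define X where "X = monom (1::'v) (degree q)"
  have dg: "degree g \<le> e" using g(2) Suc.prems(2) by simp
  have "sl2_elementary p g"
  proof (cases "g = 0")
    case True
    then have "q = c * p" using g(1) by simp
    then have "p * (s - c * r) = 1" using Suc.prems(3) by (simp add: algebra_simps)
    then show ?thesis by (metis dvd_triv_left sl2_elementary_unit)
  next
    case False
    from ex_smult_content[OF V this] obtain b h i where
      h: "g = smult b h" "degree h \<le> degree g" "coeff h i = 1"
      by (elim exE conjE) (rule that)
    have hi: "coeff h i dvd 1" and he: "degree h \<le> e" using h(2,3) dg by auto
    from divide_to_unit_constant_term[OF V Suc.prems(1,2) hi he] obtain c' m w where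
      w: "h = c' * p + monom 1 m * w" "coeff w 0 dvd 1" "degree w \<le> e" by blast
    have q: "q = c * p + X * ([:b:] * h)" using g(1) h(1) by (simp add: X_def)
    have "sl2_elementary w p"
    proof (rule Suc.IH[OF w(2,3)])
      show "w * (- (X * [:b:] * monom 1 m * r)) - p * (- (s - c * r - X * [:b:] * c' * r)) = 1"
        using Suc.prems(3) unfolding q w(1) by (simp add: algebra_simps)
    qed
    then have "sl2_elementary p w" by (rule sl2_elementary_swap)
    then have "sl2_elementary p (monom 1 m * w)"
      by (rule sl2_elementary_drop_monom[OF Suc.prems(1)])
    moreover have "h + (- c') * p = monom 1 m * w" using w(1) by (simp add: algebra_simps)
    ultimately have "sl2_elementary p (h + (- c') * p)" by simp
    then have S: "sl2_elementary p h" by (rule sl2_elementary_add_right)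
    have "(s - c * r) * p + (- (X * h * r)) * [:b:] = 1"
      using Suc.prems(3) unfolding q by (simp add: algebra_simps)
    from sl2_elementary_drop_constant_factor[OF V Suc.prems(1) this S]
    show ?thesis using h(1) by simp
  qed
  then have "sl2_elementary p (monom 1 (degree q) * g)"
    by (rule sl2_elementary_drop_monom[OF Suc.prems(1)])
  moreover have "q + (- c) * p = monom 1 (degree q) * g"
    using arg_cong[OF g(1), of "\<lambda>x. x + (- c) * p"] by simp
  ultimately have "sl2_elementary p (q + (- c) * p)" by simp
  then show ?case by (rule sl2_elementary_add_right)
qed

lemma mat3_block_in_E:
  fixes p q r s :: "'v::comm_ring_1 poly"
  assumes V: "valuation_ring TYPE('v)" and det: "p * s - q * r = 1"
  shows "mat3 p q 0 r s 0 0 0 1 \<in> E 3"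
proof -
  have "coeff p 0 * coeff s 0 + - (coeff q 0 * coeff r 0) dvd 1"
    using arg_cong[OF det, of "\<lambda>x. coeff x 0"] by (simp add: coeff_mult)
  from dvd_one_add[OF V this] have "coeff p 0 dvd 1 \<or> coeff q 0 dvd 1"
    by (metis dvd_mult_left minus_dvd_iff)
  then have "sl2_elementary p q"
  proof
    assume "coeff p 0 dvd 1"
    from sl2_elementary_of_unit_constant_term[OF V this order_refl det] show ?thesis .
  next
    assume q: "coeff q 0 dvd 1"
    have "q * (- r) - p * (- s) = 1" using det by (simp add: algebra_simps)
    from sl2_elementary_of_unit_constant_term[OF V q order_refl this] show ?thesis
      by (rule sl2_elementary_swap)
  qed
  with det show ?thesis unfolding sl2_elementary_def by blast
qed

section \<open>Block embeddings and the induction on the size\<close>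

definition block_one :: "nat \<Rightarrow> 'a::comm_ring_1 mat \<Rightarrow> 'a mat" where
  "block_one m N = four_block_mat N (0\<^sub>m m 1) (0\<^sub>m 1 m) (1\<^sub>m 1)"

lemma block_one_in_SL_iff:
  fixes N :: "'a::comm_ring_1 mat"
  assumes "N \<in> carrier_mat m m"
  shows "block_one m N \<in> carrier (SL (Suc m)) \<longleftrightarrow> N \<in> carrier (SL m)"
proof -
  have "det (block_one m N) = det N * det (1\<^sub>m 1)"
    unfolding block_one_def by (rule det_four_block_mat_upper_right_zero_col) (use assms in auto)
  moreover have "block_one m N \<in> carrier_mat (Suc m) (Suc m)"
    using four_block_carrier_mat[OF assms, of "1\<^sub>m 1" 1 1] by (simp add: block_one_def)
  ultimately show ?thesis using assms by simp
qed

text \<open>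
  The embedding is a group homomorphism that maps elementary matrices to elementary matrices, hence
  the generated subgroup into the generated subgroup.
\<close>

lemma block_one_in_E:
  fixes N :: "'a::comm_ring_1 mat"
  assumes "N \<in> E m"
  shows "block_one m N \<in> E (Suc m)"
proof -
  interpret G: group "SL m :: 'a mat monoid" by (rule group_SL)
  interpret H: group "SL (Suc m) :: 'a mat monoid" by (rule group_SL)
  have mult: "block_one m A * block_one m B = block_one m (A * B)"
    if "A \<in> carrier_mat m m" "B \<in> carrier_mat m m" for A B :: "'a mat"
    unfolding block_one_def using that
    by (subst mult_four_block_mat[of _ m m _ 1 _ 1 _ _ m _ 1]) auto
  then interpret group_hom "SL m :: 'a mat monoid" "SL (Suc m)" "block_one m"
  proof unfold_locales
    have "block_one m A \<in> carrier (SL (Suc m))" if "A \<in> carrier (SL m)" for A :: "'a mat"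
      using that block_one_in_SL_iff[of A m] by simp
    with mult show "block_one m \<in> hom (SL m :: 'a mat monoid) (SL (Suc m))"
      unfolding hom_def by (auto simp: Pi_def simp del: SL_simps(1)) simp
  qed
  have "block_one m ` elementary_mats m \<subseteq> (elementary_mats (Suc m) :: 'a mat set)"
  proof clarify
    fix A :: "'a mat" assume "A \<in> elementary_mats m"
    then obtain a i j where A: "A = addrow_mat m a i j" "i < m" "j < m" "i \<noteq> j"
      by (auto simp: elementary_mats_def)
    have "block_one m A = addrow_mat (Suc m) a i j"
      unfolding A(1) block_one_def using A(2-) by (intro eq_matI) (auto simp: less_Suc_eq)
    with A show "block_one m A \<in> elementary_mats (Suc m)"
      unfolding elementary_mats_def by force
  qed
  from H.mono_generate[OF this] generate_img[OF elementary_mats_subset_SL] assms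
  show ?thesis unfolding E_def by blast
qed

lemma det_2_by_2:
  assumes A: "A \<in> carrier_mat 2 2"
  shows "det A = A $$ (0,0) * A $$ (1,1) - A $$ (0,1) * A $$ (1,0)"
proof -
  have "det (mat_delete A 0 j) = A $$ (1, 1 - j)" if "j < 2" for j
    using A that by (subst det_single) (auto simp: mat_delete_def less_2_cases_iff)
  then show ?thesis
    using A by (simp add: laplace_expansion_row[OF A, of 0] cofactor_def numeral_2_eq_2)
qed

lemma block_one_of_SL2:
  fixes N :: "'v::comm_ring_1 poly mat"
  assumes V: "valuation_ring TYPE('v)" and N: "N \<in> carrier (SL 2)"
  shows "block_one 2 N \<in> E 3"
proof -
  have Nc: "N \<in> carrier_mat 2 2" and d: "det N = 1" using N by auto
  have "N $$ (0,0) * N $$ (1,1) - N $$ (0,1) * N $$ (1,0) = 1"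
    using det_2_by_2[OF Nc] d by simp
  from mat3_block_in_E[OF V this]
  have "mat3 (N $$ (0,0)) (N $$ (0,1)) 0 (N $$ (1,0)) (N $$ (1,1)) 0 0 0 1 \<in> E 3" .
  moreover have "mat3 (N $$ (0,0)) (N $$ (0,1)) 0 (N $$ (1,0)) (N $$ (1,1)) 0 0 0 1 = block_one 2 N"
    using Nc by (intro eq_matI) (auto simp: mat3_def mat_of_rows_list_def block_one_def
        numeral_3_eq_3 numeral_2_eq_2 less_Suc_eq)
  ultimately show ?thesis by simp
qed

lemma clear_last_column:
  fixes A :: "'a::comm_ring_1 mat"
  assumes A: "A \<in> carrier_mat (Suc m) (Suc m)"
    and row: "\<And>j. j \<le> m \<Longrightarrow> A $$ (m, j) = (if j = m then 1 else 0)"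
  shows "k \<le> m \<Longrightarrow> \<exists>P\<in>E (Suc m). (\<forall>i<k. (P * A) $$ (i, m) = 0) \<and>
    (\<forall>j\<le>m. (P * A) $$ (m, j) = (if j = m then 1 else 0))"
proof (induction k)
  case 0
  show ?case using A row E_one by (intro bexI[of _ "1\<^sub>m (Suc m)"]) auto
next
  case (Suc k)
  then obtain P where P: "P \<in> E (Suc m)" "\<forall>i<k. (P * A) $$ (i, m) = 0"
    "\<forall>j\<le>m. (P * A) $$ (m, j) = (if j = m then 1 else 0)" by auto
  define B where "B = P * A"
  have B: "B \<in> carrier_mat (Suc m) (Suc m)" using E_carrier[OF P(1)] A by (simp add: B_def)
  let ?R = "addrow_mat (Suc m) (- B $$ (k, m)) k m"
  have R: "?R \<in> E (Suc m)" using Suc.prems by (intro addrow_mat_in_E) auto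
  have "?R * P * A = ?R * B"
    unfolding B_def by (rule assoc_mult_mat[OF addrow_mat_carrier E_carrier[OF P(1)] A])
  also have "\<dots> = addrow (- B $$ (k, m)) k m B"
    using addrow_mat[OF B, of m] by simp
  finally have RPA: "?R * P * A = addrow (- B $$ (k, m)) k m B" .
  have "(\<forall>i<Suc k. (?R * P * A) $$ (i, m) = 0) \<and>
    (\<forall>j\<le>m. (?R * P * A) $$ (m, j) = (if j = m then 1 else 0))"
    unfolding RPA using B P(2,3)[folded B_def] Suc.prems by (auto simp: less_Suc_eq)
  with E_mult[OF R P(1)] show ?case by blast
qed

text \<open>
  The last row is unimodular, hence elementary equivalent to the last unit vector; clearing the last
  column leaves a block of size \<open>m\<close>.
\<close>

lemma SL_Suc_subset_E:
  fixes A :: "'v::comm_ring_1 poly mat"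
  assumes V: "valuation_ring TYPE('v)" and m: "m \<ge> 2"
    and block: "\<And>N :: 'v poly mat. N \<in> carrier (SL m) \<Longrightarrow> block_one m N \<in> E (Suc m)"
    and A: "A \<in> carrier (SL (Suc m))"
  shows "A \<in> E (Suc m)"
proof -
  have Ac: "A \<in> carrier_mat (Suc m) (Suc m)" and d: "det A = 1" using A by auto
  have adj: "adj_mat A \<in> carrier_mat (Suc m) (Suc m)" "A * adj_mat A = 1\<^sub>m (Suc m)"
    using adj_mat[OF Ac] d by auto
  have "(A * adj_mat A) $$ (m, m) = 1" using adj(2) by simp
  then have "(\<Sum>j<Suc m. adj_mat A $$ (j, m) * A $$ (m, j)) = 1"
    using Ac adj(1) by (simp add: scalar_prod_def mult.commute atLeast0LessThan del: sum.lessThan_Suc)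
  then have "unimodular (Suc m) (\<lambda>j. A $$ (m, j))"
    unfolding unimodular_def by (rule exI[of _ "\<lambda>j. adj_mat A $$ (j, m)"])
  from unimodular_row_equiv_unit_vector[OF V _ this, of m] m obtain w where
    w: "row_equiv (Suc m) (\<lambda>j. A $$ (m, j)) w" "\<forall>j<Suc m. w j = (if j = m then 1 else 0)" by auto
  from row_equiv_realised_in_E[OF Ac _ w(1)] obtain P where
    P: "P \<in> E (Suc m)" "\<forall>j<Suc m. (A * P) $$ (m, j) = w j" by auto
  have AP: "A * P \<in> carrier_mat (Suc m) (Suc m)" using Ac E_carrier[OF P(1)] by simp
  have "(A * P) $$ (m, j) = (if j = m then 1 else 0)" if "j \<le> m" for j
    using P(2) w(2) that by (metis less_Suc_eq_le)
  from clear_last_column[OF AP this order_refl] obtain Q where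
    Q: "Q \<in> E (Suc m)" "\<forall>i<m. (Q * (A * P)) $$ (i, m) = 0"
      "\<forall>j\<le>m. (Q * (A * P)) $$ (m, j) = (if j = m then 1 else 0)" by blast
  define C where "C = Q * (A * P)"
  have "C \<in> carrier (SL (Suc m))"
    unfolding C_def
    by (intro SL_mult A subsetD[OF E_subset P(1)] subsetD[OF E_subset Q(1)])
  then have Cc: "C \<in> carrier_mat (Suc m) (Suc m)" by simp
  define N where "N = mat m m (\<lambda>ij. C $$ ij)"
  have Nc: "N \<in> carrier_mat m m" by (simp add: N_def)
  have CN: "C = block_one m N"
    using Cc Q(2,3)[folded C_def] by (intro eq_matI) (auto simp: block_one_def N_def less_Suc_eq)
  then have "N \<in> carrier (SL m)"
    using \<open>C \<in> carrier (SL (Suc m))\<close> block_one_in_SL_iff[OF Nc] by simp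
  then have "Q * (A * P) \<in> E (Suc m)" using block CN C_def by simp
  then show ?thesis by (intro E_cancel_right[OF P(1) Ac] E_cancel_left[OF Q(1) AP])
qed

lemma SL_subset_E:
  assumes V: "valuation_ring TYPE('v::comm_ring_1)" and "n \<ge> 3"
  shows "carrier (SL n) \<subseteq> (E n :: 'v poly mat set)"
  using assms(2)
proof (induction n rule: dec_induct)
  case base
  have "A \<in> E (Suc 2)" if "A \<in> carrier (SL (Suc 2))" for A :: "'v poly mat"
    by (rule SL_Suc_subset_E[OF V _ _ that]) (use block_one_of_SL2[OF V] in \<open>auto simp del: SL_simps\<close>)
  then show ?case by (auto simp del: SL_simps)
next
  case (step n)
  show ?case
  proof
    fix A :: "'v poly mat" assume "A \<in> carrier (SL (Suc n))"
    moreover have "block_one n N \<in> E (Suc n)" if "N \<in> carrier (SL n)" for N :: "'v poly mat"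
      using step.IH that by (intro block_one_in_E) (rule subsetD)
    moreover have "n \<ge> 2" using step.hyps by simp
    ultimately show "A \<in> E (Suc n)" using SL_Suc_subset_E[OF V] by blast
  qed
qed

theorem theorem4p3:
  fixes n :: nat
  assumes "valuation_ring TYPE('v::comm_ring_1)" and "n \<ge> 3"
  shows "carrier (SL n) = (E n :: 'v poly mat set) \<and>
    (\<forall>\<sigma> \<in> carrier (SL n :: 'v poly mat monoid).
       \<exists>\<epsilon> \<in> E n. \<sigma> * \<epsilon> = const_mat (eval_mat \<sigma> 0))"
proof (intro conjI ballI)
  show SL_E: "carrier (SL n) = (E n :: 'v poly mat set)"
    using SL_subset_E[OF assms] E_subset by blast
  \<comment> \<open>The second claim follows from the first: \<open>\<sigma>(0)\<close> is itself in \<open>SL\<close>, hence elementary.\<close>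
  fix \<sigma> :: "'v poly mat" assume \<sigma>: "\<sigma> \<in> carrier (SL n)"
  let ?c = "const_mat (eval_mat \<sigma> 0)"
  have c: "?c \<in> E n" using const_mat_in_SL[OF eval_mat_in_SL[OF \<sigma>]] SL_E by blast
  from \<sigma> SL_E obtain \<tau> where \<tau>: "\<tau> \<in> E n" "\<sigma> * \<tau> = 1\<^sub>m n" using E_inverse by blast
  have "\<sigma> * (\<tau> * ?c) = (\<sigma> * \<tau>) * ?c"
    using assoc_mult_mat[OF _ E_carrier[OF \<tau>(1)] E_carrier[OF c], of \<sigma> n] \<sigma> by simp
  also have "\<dots> = ?c" using \<tau>(2) E_carrier[OF c] by simp
  finally show "\<exists>\<epsilon>\<in>E n. \<sigma> * \<epsilon> = ?c" using E_mult[OF \<tau>(1) c] by blast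
qed

end
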